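(* Let $B$ be Hamilton's quaternion algebra over $\mathbb{Q}$, that is, the rational quaternion algebra with basis $\{1,I,J,IJ\}$ such that $I^2=J^2=-1$ and $IJ=-JI$. Let $\mathcal{D}$ be the maximal order $$\mathbb{Z}\left[1,I,J,\frac{1+I+J+IJ}{2}\right]$$ and let $S=\{\infty,\ell_1,\dots,\ell_h\}$ be a set of places of $\mathbb{Q}$ containing the archimedean place $\infty$ and any set $\{\ell_i\}_{i=1}^h$ of distinct odd primes. Then the unit group $\mathcal{D}_S^*$ is generated by the finite set of elements of $\mathcal{D}$ with reduced norm contained in $\{1,\ell_1,\dots,\ell_h\}$.
   Context: $\mathcal{D}_S=\mathbb{Z}[1/\ell_1,\dots,1/\ell_h]\otimes_{\mathbb{Z}}\mathcal{D}$ and $\mathcal{D}_S^*$ is its group of invertible elements. The reduced norm of $a+bI+cJ+dIJ$ ($a,b,c,d\in\mathbb{Q}$) is $a^2+b^2+c^2+d^2$. *)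

theory Defs
  imports "HOL-Algebra.Algebra" "HOL-Algebra.Algebraic_Closure_Type"
    "HOL-Computational_Algebra.Primes"
begin

text \<open>
  Hamilton's quaternion algebra over the rationals: \<open>Quat a b c d\<close> stands for
  \<open>a + b I + c J + d IJ\<close> (see \<open>Quat_basis\<close> below).
\<close>

datatype rquat = Quat (qre: rat) (qi: rat) (qj: rat) (qk: rat)

instantiation rquat :: ring_1
begin

definition "0 = Quat 0 0 0 0"
definition "1 = Quat 1 0 0 0"
definition "x + y = Quat (qre x + qre y) (qi x + qi y) (qj x + qj y) (qk x + qk y)"
definition "- x = Quat (- qre x) (- qi x) (- qj x) (- qk x)"
definition "x - y = Quat (qre x - qre y) (qi x - qi y) (qj x - qj y) (qk x - qk y)"
definition "x * y = Quat
  (qre x * qre y - qi x * qi y - qj x * qj y - qk x * qk y)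
  (qre x * qi y + qi x * qre y + qj x * qk y - qk x * qj y)
  (qre x * qj y - qi x * qk y + qj x * qre y + qk x * qi y)
  (qre x * qk y + qi x * qj y - qj x * qi y + qk x * qre y)"

instance
  by standard
    (auto simp: zero_rquat_def one_rquat_def plus_rquat_def uminus_rquat_def
      minus_rquat_def times_rquat_def algebra_simps)

end

lemmas rquat_defs = zero_rquat_def one_rquat_def plus_rquat_def uminus_rquat_def
  minus_rquat_def times_rquat_def

definition qI :: rquat where "qI = Quat 0 1 0 0"
definition qJ :: rquat where "qJ = Quat 0 0 1 0"

definition qscale :: "rat \<Rightarrow> rquat \<Rightarrow> rquat" where
  "qscale r x = Quat (r * qre x) (r * qi x) (r * qj x) (r * qk x)"

definition reduced_norm :: "rquat \<Rightarrow> rat" where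
  "reduced_norm x = (qre x)\<^sup>2 + (qi x)\<^sup>2 + (qj x)\<^sup>2 + (qk x)\<^sup>2"

lemma Quat_relations: "qI * qI = - 1" "qJ * qJ = - 1" "qI * qJ = - (qJ * qI)"
  by (simp_all add: rquat_defs qI_def qJ_def)

lemma Quat_basis:
  "Quat a b c d = qscale a 1 + qscale b qI + qscale c qJ + qscale d (qI * qJ)"
  by (simp add: rquat_defs qI_def qJ_def qscale_def)

lemma qscale_mult: "qscale r x * y = qscale r (x * y)" "x * qscale r y = qscale r (x * y)"
  by (simp_all add: rquat_defs qscale_def algebra_simps)

definition hamilton_Q :: "rquat ring" where
  "hamilton_Q = ring_of_type_algebra"

lemma hamilton_Q_simps [simp]:
  "carrier hamilton_Q = UNIV" "x \<otimes>\<^bsub>hamilton_Q\<^esub> y = x * y" "x \<oplus>\<^bsub>hamilton_Q\<^esub> y = x + y"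
  "\<one>\<^bsub>hamilton_Q\<^esub> = 1" "\<zero>\<^bsub>hamilton_Q\<^esub> = 0"
  by (simp_all add: hamilton_Q_def ring_of_type_algebra_def)

lemma ring_hamilton_Q: "ring hamilton_Q"
proof -
  have "\<exists>y. x + y = 0" "\<exists>y. y + x = 0" for x :: rquat
    using add.right_inverse add.left_inverse by blast+
  then show ?thesis
    by unfold_locales (auto simp: algebra_simps Units_def)
qed

lemma a_inv_hamilton_Q [simp]: "\<ominus>\<^bsub>hamilton_Q\<^esub> x = - x"
proof -
  interpret ring hamilton_Q by (rule ring_hamilton_Q)
  show ?thesis by (rule minus_equality) auto
qed

definition hurwitz_order :: "rquat set" where
  "hurwitz_order =
     generate_ring hamilton_Q {1, qI, qJ, qscale (1/2) (1 + qI + qJ + qI * qJ)}"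

definition inverted_ints :: "nat set \<Rightarrow> rat set" where
  "inverted_ints P = generate_ring (ring_of_type_algebra :: rat ring) ((\<lambda>p. 1 / of_nat p) ` P)"

text \<open>
  The tensor product \<open>R \<otimes>\<^sub>\<int> \<D>\<close> with \<open>R = \<int>[1/p : p \<in> P]\<close> is realised inside the quaternion
  algebra \<open>\<rat> \<otimes>\<^sub>\<int> \<D>\<close>: since \<open>\<D>\<close> is free over \<open>\<int>\<close>, the map induced by \<open>R \<subseteq> \<rat>\<close> is injective,
  and its image is the additive subgroup generated by the products \<open>r x\<close>, which stand for
  the pure tensors.
\<close>

definition S_order_set :: "nat set \<Rightarrow> rquat set" where
  "S_order_set P = generate (add_monoid hamilton_Q)
     {qscale r x | r x. r \<in> inverted_ints P \<and> x \<in> hurwitz_order}"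

definition S_order :: "nat set \<Rightarrow> rquat ring" where
  "S_order P = hamilton_Q \<lparr> carrier := S_order_set P \<rparr>"

definition S_unit_group :: "nat set \<Rightarrow> rquat monoid" where
  "S_unit_group P = units_of (S_order P)"

lemma hurwitz_order_subring: "subring hurwitz_order hamilton_Q"
  unfolding hurwitz_order_def
  by (rule ring.generate_ring_is_subring[OF ring_hamilton_Q]) simp

lemma inverted_ints_subring: "subring (inverted_ints P) (ring_of_type_algebra :: rat ring)"
  unfolding inverted_ints_def
  by (rule ring.generate_ring_is_subring[OF ring_from_type_algebra])
    (simp add: ring_of_type_algebra_def)

lemma inverted_ints_closed:
  "1 \<in> inverted_ints P"
  "r \<in> inverted_ints P \<Longrightarrow> s \<in> inverted_ints P \<Longrightarrow> r * s \<in> inverted_ints P"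
  using subringE(3,6)[OF inverted_ints_subring[of P]]
  by (simp_all add: ring_of_type_algebra_def)

lemma hurwitz_order_closed:
  "1 \<in> hurwitz_order"
  "x \<in> hurwitz_order \<Longrightarrow> y \<in> hurwitz_order \<Longrightarrow> x * y \<in> hurwitz_order"
  using subringE(3,6)[OF hurwitz_order_subring] by simp_all

lemma hurwitz_order_subset_S_order: "hurwitz_order \<subseteq> carrier (S_order P)"
proof
  fix x assume "x \<in> hurwitz_order"
  moreover have "qscale 1 x = x"
    by (simp add: qscale_def)
  ultimately have "\<exists>r y. x = qscale r y \<and> r \<in> inverted_ints P \<and> y \<in> hurwitz_order"
    using inverted_ints_closed(1)[of P] by metis
  then show "x \<in> carrier (S_order P)"
    by (simp add: S_order_def S_order_set_def generate.incl)
qed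

lemma S_order_subring: "subring (S_order_set P) hamilton_Q"
proof -
  interpret ring hamilton_Q by (rule ring_hamilton_Q)
  let ?T = "{qscale r x | r x. r \<in> inverted_ints P \<and> x \<in> hurwitz_order}"
  have sub: "subgroup (S_order_set P) (add_monoid hamilton_Q)"
    unfolding S_order_set_def by (rule add.generate_is_subgroup) simp
  have neg: "inv\<^bsub>add_monoid hamilton_Q\<^esub> u = - u" for u
    using a_inv_hamilton_Q[of u] unfolding a_inv_def .
  have closed: "0 \<in> S_order_set P" "u \<in> S_order_set P \<Longrightarrow> - u \<in> S_order_set P"
    "u \<in> S_order_set P \<Longrightarrow> v \<in> S_order_set P \<Longrightarrow> u + v \<in> S_order_set P" for u v
    using subgroup.one_closed[OF sub] subgroup.m_inv_closed[OF sub, of u, unfolded neg]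
      subgroup.m_closed[OF sub, of u v] by simp_all
  have T: "u * v \<in> ?T" if uv: "u \<in> ?T" "v \<in> ?T" for u v
  proof -
    obtain r x s y where "r \<in> inverted_ints P" "s \<in> inverted_ints P"
      "x \<in> hurwitz_order" "y \<in> hurwitz_order" "u = qscale r x" "v = qscale s y"
      using uv by auto
    moreover have "qscale r x * qscale s y = qscale (r * s) (x * y)"
      by (simp add: qscale_mult) (simp add: qscale_def mult_ac)
    ultimately show ?thesis
      using inverted_ints_closed(2) hurwitz_order_closed(2) by (metis (mono_tags, lifting) mem_Collect_eq)
  qed
  have TS: "u \<in> S_order_set P" if "u \<in> ?T" for u
    unfolding S_order_set_def using that by (rule generate.incl)
  have 1: "u * t \<in> S_order_set P" if u: "u \<in> S_order_set P" and t: "t \<in> ?T" for u t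
    using u[unfolded S_order_set_def]
  proof (induction rule: generate.induct)
    case one then show ?case using closed(1) by simp
  next
    case (incl a) then show ?case using TS[OF T[OF incl t]] by simp
  next
    case (inv a) then show ?case using closed(2)[OF TS[OF T[OF inv t]]] unfolding neg by simp
  next
    case (eng a b)
    then show ?case using closed(3)[of "a * t" "b * t"] by (simp add: distrib_right)
  qed
  have 2: "u * v \<in> S_order_set P" if u: "u \<in> S_order_set P" and v: "v \<in> S_order_set P" for u v
    using v[unfolded S_order_set_def]
  proof (induction rule: generate.induct)
    case one then show ?case using closed(1) by simp
  next
    case (incl a) then show ?case using 1[OF u incl] by simp
  next
    case (inv a) then show ?case using closed(2)[OF 1[OF u inv]] unfolding neg by simp
  next
    case (eng a b)
    then show ?case using closed(3)[of "u * a" "u * b"] by (simp add: distrib_left)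
  qed
  show ?thesis
    using closed 2 hurwitz_order_subset_S_order[of P] hurwitz_order_closed(1)
    by (intro subringI) (auto simp: S_order_def)
qed

lemma ring_S_order: "ring (S_order P)"
proof -
  interpret ring hamilton_Q by (rule ring_hamilton_Q)
  show ?thesis
    unfolding S_order_def using S_order_subring subring_is_ring by blast
qed

lemma group_S_unit_group: "group (S_unit_group P)"
proof -
  interpret ring "S_order P" by (rule ring_S_order)
  show ?thesis unfolding S_unit_group_def by (rule units_group)
qed

end

theory Submission
  imports Defs
begin

text \<open>
  The Hurwitz order \<open>\<D>\<close> is norm-Euclidean, so its right ideals are principal. Suppose \<open>x \<in> \<D>\<close> has norm
  divisible by an odd prime \<open>p\<close>. A generator \<open>g\<close> of \<open>x \<D> + p \<D>\<close> has norm dividing \<open>p\<^sup>2\<close>. The norm is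
  not \<open>1\<close>, since \<open>1 = x u + p v\<close> would make \<open>N (1 - p v) = N x N u\<close> both \<open>1\<close> and \<open>0\<close> modulo \<open>p\<close>;
  it is \<open>p\<^sup>2\<close> only when \<open>p\<close> divides \<open>x\<close>. Applied to \<open>a + b I + J\<close> with \<open>p\<close> dividing
  \<open>a\<^sup>2 + b\<^sup>2 + 1\<close>, this yields an element of norm \<open>p\<close>, which splits off from every multiple of \<open>p\<close>.
  Hence every element of \<open>\<D>\<close> with norm a product of primes in \<open>P\<close> is a product of elements of norm in
  \<open>P\<close> and of units of \<open>\<D>\<close>. For an \<open>S\<close>-unit \<open>u\<close>, clearing denominators gives such elements \<open>n\<close> and
  \<open>n u\<close>, and \<open>u\<close> is their quotient.
\<close>

section \<open>Norm, scaling and conjugation\<close>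

text \<open>Euler's four-square identity.\<close>

lemma reduced_norm_mult: "reduced_norm (x * y) = reduced_norm x * reduced_norm y"
  by (simp add: reduced_norm_def rquat_defs power2_eq_square algebra_simps)

lemma reduced_norm_simps [simp]:
  "reduced_norm 0 = 0" "reduced_norm 1 = 1" "reduced_norm (qscale r x) = r\<^sup>2 * reduced_norm x"
  by (simp_all add: reduced_norm_def rquat_defs qscale_def power_mult_distrib algebra_simps)

lemma reduced_norm_eq_0_iff [simp]: "reduced_norm x = 0 \<longleftrightarrow> x = 0"
  by (cases x) (simp add: reduced_norm_def rquat_defs add_nonneg_eq_0_iff)

lemma reduced_norm_nonneg [simp]: "reduced_norm x \<ge> 0"
  by (simp add: reduced_norm_def)

lemma qscale_qscale [simp]: "qscale r (qscale s x) = qscale (r * s) x"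
  by (simp add: qscale_def mult_ac)

lemma qscale_1 [simp]: "qscale 1 x = x"
  by (simp add: qscale_def)

lemma qscale_minus: "qscale r (- x) = - qscale r x"
  by (simp add: qscale_def rquat_defs)

lemma qscale_add: "qscale r (x + y) = qscale r x + qscale r y"
  by (simp add: qscale_def rquat_defs algebra_simps)

definition qconj :: "rquat \<Rightarrow> rquat" where
  "qconj x = Quat (qre x) (- qi x) (- qj x) (- qk x)"

lemma mult_qconj: "x * qconj x = qscale (reduced_norm x) 1" "qconj x * x = qscale (reduced_norm x) 1"
  by (simp_all add: qconj_def reduced_norm_def qscale_def rquat_defs power2_eq_square)

lemma of_int_rquat: "(of_int n :: rquat) = qscale (of_int n) 1"
proof -
  have *: "(of_nat m :: rquat) = qscale (of_nat m) 1" for m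
    by (induction m) (simp_all add: qscale_def rquat_defs)
  show ?thesis
    by (cases n) (simp_all add: * qscale_def rquat_defs)
qed

section \<open>The order as a lattice with integral norm\<close>

lemma hurwitz_order_of_int_mult:
  assumes "x \<in> hurwitz_order" shows "qscale (of_int n) x \<in> hurwitz_order"
proof -
  have *: "qscale (of_nat m) x \<in> hurwitz_order" for m
  proof (induction m)
    case 0
    show ?case
      using subringE(2)[OF hurwitz_order_subring] by (simp add: qscale_def rquat_defs)
  next
    case (Suc m)
    have "qscale (of_nat (Suc m)) x = x + qscale (of_nat m) x"
      by (simp add: qscale_def rquat_defs algebra_simps)
    then show ?case
      using Suc assms subringE(7)[OF hurwitz_order_subring] by auto
  qed
  have **: "- y \<in> hurwitz_order" if "y \<in> hurwitz_order" for y
    using that subringE(5)[OF hurwitz_order_subring, of y] by simp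
  show ?thesis
  proof (cases n)
    case (nonneg m)
    then show ?thesis using * by simp
  next
    case (neg m)
    have "qscale (of_int n) x = - qscale (of_nat (Suc m)) x"
      by (simp add: neg qscale_def rquat_defs algebra_simps)
    then show ?thesis using *[of "Suc m"] ** by simp
  qed
qed

text \<open>Coordinates with respect to the \<open>\<int>\<close>-basis \<open>1, I, J, (1 + I + J + IJ) / 2\<close> of the order.\<close>
definition hurwitz :: "int \<Rightarrow> int \<Rightarrow> int \<Rightarrow> int \<Rightarrow> rquat" where
  "hurwitz a b c d = Quat (of_int a + of_int d / 2) (of_int b + of_int d / 2)
     (of_int c + of_int d / 2) (of_int d / 2)"

text \<open>The four coordinates of the product are integral polynomials in the coordinates of the
  factors, so the lattice is closed under multiplication.\<close>

lemma hurwitz_mult: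
  "hurwitz a b c d  *  hurwitz a' b' c' d' =
   hurwitz (a * a' - b * b' - c * c' - b * d' - d * c' - d * d' + c * b' - b * c')
     (a * b' + b * a' + d * b' + c * d' - d * c' - b * c' + c * b')
     (a * c' + c * a' + d * b' + c * d' - b * d' + c * b' - b * c')
     (a * d' + 2 * b * c' + b * d' + d * c' - 2 * c * b' - c * d' - d * b' + d * a' + d * d')"
proof -
  \<comment> \<open>Replacing \<open>d\<close> by \<open>2 * e\<close> and \<open>d'\<close> by
    \<open>2 * e'\<close> clears the halves and leaves polynomial identities over the
    rationals.\<close>
  define e e' :: rat where "e = of_int d / 2" and "e' = of_int d' / 2"
  then have "of_int d = 2 * e" "of_int d' = 2 * e'" by simp_all
  then show ?thesis
    by (simp add: hurwitz_def rquat_defs add_divide_distrib diff_divide_distrib algebra_simps)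
qed

lemma hurwitz_add: "hurwitz a b c d + hurwitz a' b' c' d' = hurwitz (a + a') (b + b') (c + c') (d + d')"
  by (simp add: hurwitz_def rquat_defs add_divide_distrib)

lemma hurwitz_minus: "- hurwitz a b c d = hurwitz (-a) (-b) (-c) (-d)"
  by (simp add: hurwitz_def rquat_defs)

text \<open>The lattice contains the ring generators and is closed under the ring operations, so it
  contains the order. Conversely, its elements are integral combinations of the generators.
  Membership thereby becomes a matter of integer coordinates.\<close>

lemma hurwitz_order_eq: "hurwitz_order = {hurwitz a b c d | a b c d. True}"
proof (intro equalityI subsetI)
  fix x assume "x \<in> hurwitz_order"
  then show "x \<in> {hurwitz a b c d | a b c d. True}"
    unfolding hurwitz_order_def
  proof (induction rule: generate_ring.induct)
    case one
    have "1 = hurwitz 1 0 0 0" by (simp add: hurwitz_def rquat_defs)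
    then show ?case by auto
  next
    case (incl x)
    have "1 = hurwitz 1 0 0 0" "qI = hurwitz 0 1 0 0" "qJ = hurwitz 0 0 1 0"
      "qscale (1/2) (1 + qI + qJ + qI * qJ) = hurwitz 0 0 0 1"
      by (simp_all add: hurwitz_def rquat_defs qI_def qJ_def qscale_def)
    then show ?case using incl by blast
  next
    case (a_inv x)
    then show ?case using hurwitz_minus by fastforce
  next
    case (eng_add x y)
    then show ?case using hurwitz_add by fastforce
  next
    case (eng_mult x y)
    then show ?case using hurwitz_mult by fastforce
  qed
next
  fix x assume "x \<in> {hurwitz a b c d | a b c d. True}"
  then obtain a b c d where x: "x = hurwitz a b c d" by blast
  have "x = qscale (of_int a) 1 + qscale (of_int b) qI + qscale (of_int c) qJ
      + qscale (of_int d) (qscale (1/2) (1 + qI + qJ + qI * qJ))"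
    by (simp add: x hurwitz_def rquat_defs qI_def qJ_def qscale_def)
  moreover have "y \<in> hurwitz_order"
    if "y \<in> {1, qI, qJ, qscale (1/2) (1 + qI + qJ + qI * qJ)}" for y
    unfolding hurwitz_order_def using that by (rule generate_ring.incl)
  moreover have "y + z \<in> hurwitz_order" if "y \<in> hurwitz_order" "z \<in> hurwitz_order" for y z
    using that subringE(7)[OF hurwitz_order_subring] by simp
  ultimately show "x \<in> hurwitz_order"
    using hurwitz_order_of_int_mult by (simp only: insertI1 insertI2)
qed

lemma hurwitz_orderE:
  assumes "x \<in> hurwitz_order" obtains a b c d where "x = hurwitz a b c d"
  using assms by (auto simp: hurwitz_order_eq)

lemma hurwitz_in_order [simp, intro]: "hurwitz a b c d \<in> hurwitz_order"
  by (auto simp: hurwitz_order_eq)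

lemma hurwitz_order_add: "x \<in> hurwitz_order \<Longrightarrow> y \<in> hurwitz_order \<Longrightarrow> x + y \<in> hurwitz_order"
  using subringE(7)[OF hurwitz_order_subring] by simp

lemma hurwitz_order_minus: "x \<in> hurwitz_order \<Longrightarrow> - x \<in> hurwitz_order"
  using subringE(5)[OF hurwitz_order_subring, of x] by simp

lemma hurwitz_order_of_int: "of_int n \<in> hurwitz_order"
  using hurwitz_order_of_int_mult[OF hurwitz_order_closed(1)] by (simp add: of_int_rquat)

lemma hurwitz_order_qconj:
  assumes "x \<in> hurwitz_order" shows "qconj x \<in> hurwitz_order"
proof -
  obtain a b c d where "x = hurwitz a b c d" using assms by (rule hurwitz_orderE)
  \<comment> \<open>The conjugate is the trace minus \<open>x\<close>, and the trace of
    \<open>hurwitz a b c d\<close> is the integer \<open>2 * a + d\<close>.\<close>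
  then have "qconj x = hurwitz (a + d) (- b) (- c) (- d)"
    by (simp add: qconj_def hurwitz_def)
  then show ?thesis by simp
qed

lemma reduced_norm_hurwitz:
  "reduced_norm (hurwitz a b c d) = of_int (a\<^sup>2 + b\<^sup>2 + c\<^sup>2 + d\<^sup>2 + (a + b + c) * d)"
proof -
  define e :: rat where "e = of_int d / 2"
  then have "of_int d = 2 * e" by simp
  then show ?thesis
    by (simp add: reduced_norm_def hurwitz_def power2_eq_square algebra_simps)
qed

lemma reduced_norm_nat:
  assumes "x \<in> hurwitz_order" obtains n :: nat where "reduced_norm x = of_nat n"
proof -
  obtain m :: int where m: "reduced_norm x = of_int m"
    using hurwitz_orderE[OF assms] reduced_norm_hurwitz by metis
  then have "m \<ge> 0" using reduced_norm_nonneg[of x] by simp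
  with m have "reduced_norm x = of_nat (nat m)" by simp
  then show ?thesis using that by blast
qed

text \<open>A bound on the norm bounds each rational coordinate, hence each of the four lattice
  coordinates.\<close>

lemma finite_hurwitz_order_reduced_norm:
  "finite {x \<in> hurwitz_order. reduced_norm x \<le> of_nat n}"
proof -
  \<comment> \<open>The bounds \<open>2 * n\<close> on the absolute values of \<open>d\<close> and
    \<open>2 * a + d\<close> give \<open>2 * n\<close> for \<open>a\<close>, and likewise for
    \<open>b\<close> and \<open>c\<close>.\<close>
  define B where "B = {- 2 * int n..2 * int n}"
  define f where "f = (\<lambda>(a, b, c, d). hurwitz a b c d)"
  \<comment> \<open>Crude but free of square roots: the square is at most \<open>n\<close>, and
    \<open>n\<close> is at most its own square.\<close>
  have bound: "\<bar>r\<bar> \<le> of_nat n" if "r\<^sup>2 \<le> of_nat n" for r :: rat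
  proof -
    have "r\<^sup>2 \<le> of_nat (n * n)" using that le_square[of n] by (metis of_nat_le_iff order_trans)
    then have "r\<^sup>2 \<le> (of_nat n)\<^sup>2" by (simp add: power2_eq_square)
    then show ?thesis by (simp only: abs_le_square_iff[symmetric] abs_of_nat)
  qed
  have "x \<in> f ` (B \<times> B \<times> B \<times> B)" if x: "x \<in> hurwitz_order" "reduced_norm x \<le> of_nat n" for x
  proof -
    obtain a b c d where h: "x = hurwitz a b c d" using x(1) by (rule hurwitz_orderE)
    have le: "w \<le> s" "t \<le> s" "u \<le> s" "v \<le> s"
      if "t + u + v + w \<le> s" "0 \<le> t" "0 \<le> u" "0 \<le> v" "0 \<le> w" for t u v w s :: rat
      using that by linarith+
    have "(of_int d / 2 :: rat)\<^sup>2 \<le> of_nat n" "(of_int a + of_int d / 2 :: rat)\<^sup>2 \<le> of_nat n"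
      "(of_int b + of_int d / 2 :: rat)\<^sup>2 \<le> of_nat n" "(of_int c + of_int d / 2 :: rat)\<^sup>2 \<le> of_nat n"
      by (rule le[OF x(2)[unfolded h reduced_norm_def hurwitz_def rquat.sel]]; simp)+
    note this[THEN bound]
    then have "\<bar>d\<bar> \<le> 2 * int n" "\<bar>2 * a + d\<bar> \<le> 2 * int n" "\<bar>2 * b + d\<bar> \<le> 2 * int n" "\<bar>2 * c + d\<bar> \<le> 2 * int n"
      by linarith+
    then have "(a, b, c, d) \<in> B \<times> B \<times> B \<times> B" by (auto simp: B_def)
    then show ?thesis unfolding h f_def by (intro image_eqI[of _ _ "(a, b, c, d)"]) auto
  qed
  then have "{x \<in> hurwitz_order. reduced_norm x \<le> of_nat n} \<subseteq> f ` (B \<times> B \<times> B \<times> B)" by blast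
  then show ?thesis by (rule finite_subset) (simp add: B_def)
qed

section \<open>Euclidean division and left divisors\<close>

lemma hurwitz_approx:
  obtains q where "q \<in> hurwitz_order" "reduced_norm (z - q) < 1"
proof -
  have sq: "(r - of_int (round r))\<^sup>2 \<le> 1/4" for r :: rat
  proof -
    have "\<bar>r - of_int (round r)\<bar> \<le> 1/2" using of_int_round_abs_le[of r] by (simp add: abs_minus_commute)
    then have "\<bar>r - of_int (round r)\<bar>\<^sup>2 \<le> (1/2)\<^sup>2" by (intro power_mono) auto
    then show ?thesis by (simp add: power2_eq_square)
  qed
  \<comment> \<open>The coordinate \<open>d\<close> is chosen first because it shifts the three
    others by \<open>d / 2\<close>; these are then rounded independently.\<close>
  define d where "d = round (2 * qk z)"
  define e :: rat where "e = of_int d / 2"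
  let ?r = "\<lambda>t. round (t - e)"
  let ?q = "hurwitz (?r (qre z)) (?r (qi z)) (?r (qj z)) d"
  \<comment> \<open>Rounding \<open>2 qk z\<close> leaves an error of only \<open>1/4\<close> in that coordinate, so the norm is at most \<open>13/16\<close>.\<close>
  have k: "(qk z - e)\<^sup>2 \<le> 1/16"
    using sq[of "2 * qk z"] unfolding e_def d_def by (simp add: power2_eq_square field_simps)
  have "reduced_norm (z - ?q) = (qre z - e - of_int (?r (qre z)))\<^sup>2 + (qi z - e - of_int (?r (qi z)))\<^sup>2
      + (qj z - e - of_int (?r (qj z)))\<^sup>2 + (qk z - e)\<^sup>2"
    by (simp add: reduced_norm_def hurwitz_def minus_rquat_def e_def algebra_simps)
  also have "\<dots> \<le> 1/4 + 1/4 + 1/4 + 1/16" by (intro add_mono sq k)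
  finally have "reduced_norm (z - ?q) < 1" by simp
  then show ?thesis using that[of ?q] by simp
qed

text \<open>Approximate the quotient of \<open>a\<close> by \<open>b\<close>, with the inverse of
  \<open>b\<close> on the left. Multiplying the error by \<open>b\<close> multiplies its norm by
  that of \<open>b\<close>.\<close>

lemma hurwitz_division:
  assumes "b \<noteq> 0"
  obtains q where "q \<in> hurwitz_order" "reduced_norm (a - b * q) < reduced_norm b"
proof -
  define z where "z = qscale (1 / reduced_norm b) (qconj b) * a"
  have "b * z = a"
    using assms by (simp add: z_def qscale_mult mult.assoc[symmetric] mult_qconj)
  obtain q where q: "q \<in> hurwitz_order" "reduced_norm (z - q) < 1" by (rule hurwitz_approx)
  have pos: "reduced_norm b > 0"
    using assms reduced_norm_nonneg[of b] by (simp add: less_le del: reduced_norm_nonneg)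
  have "reduced_norm (a - b * q) = reduced_norm b * reduced_norm (z - q)"
    by (simp add: reduced_norm_mult[symmetric] right_diff_distrib \<open>b * z = a\<close>)
  also have "\<dots> < reduced_norm b * 1" using pos q(2) by (intro mult_strict_left_mono)
  finally show ?thesis using that q(1) by simp
qed

text \<open>A nonzero element \<open>g\<close> of least norm in the right ideal generated by
  \<open>x\<close> and \<open>y\<close> divides every element of the ideal from the left, because
  remainders stay in the ideal.\<close>

lemma hurwitz_left_gcd:
  assumes "x \<in> hurwitz_order" "y \<in> hurwitz_order" "y \<noteq> 0"
  obtains g u v s t where "u \<in> hurwitz_order" "v \<in> hurwitz_order" "s \<in> hurwitz_order"
    "t \<in> hurwitz_order" "g = x * u + y * v" "x = g * s" "y = g * t"
proof -
  define A where "A = {x * u + y * v | u v. u \<in> hurwitz_order \<and> v \<in> hurwitz_order}"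
  have A_D: "A \<subseteq> hurwitz_order"
    using assms hurwitz_order_add hurwitz_order_closed by (auto simp: A_def)
  have 0: "0 \<in> hurwitz_order" using hurwitz_order_of_int[of 0] by simp
  have "x = x * 1 + y * 0" "y = x * 0 + y * 1" by simp_all
  then have xA: "x \<in> A" and yA: "y \<in> A"
    unfolding A_def using 0 hurwitz_order_closed(1) by blast+
  have A_diff: "a - b * q \<in> A" if ab: "a \<in> A" "b \<in> A" and q: "q \<in> hurwitz_order" for a b q
  proof -
    obtain u v u' v' where "u \<in> hurwitz_order" "v \<in> hurwitz_order" "u' \<in> hurwitz_order"
      "v' \<in> hurwitz_order" "a = x * u + y * v" "b = x * u' + y * v'"
      using ab by (auto simp: A_def)
    moreover from this have "a - b * q = x * (u + - (u' * q)) + y * (v + - (v' * q))"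
      by (simp add: algebra_simps)
    moreover have "u + - (u' * q) \<in> hurwitz_order" "v + - (v' * q) \<in> hurwitz_order"
      using calculation q
      by (simp_all only: hurwitz_order_add hurwitz_order_minus hurwitz_order_closed(2))
    ultimately show ?thesis unfolding A_def by blast
  qed
  \<comment> \<open>On the order the norm is a natural number; taking its floor makes the
    least-number principle available.\<close>
  define N where "N = (\<lambda>a. nat \<lfloor>reduced_norm a\<rfloor>)"
  have N: "reduced_norm a = of_nat (N a)" if a: "a \<in> A" for a
  proof -
    obtain n where "reduced_norm a = of_nat n" using a A_D reduced_norm_nat by blast
    then show ?thesis by (simp add: N_def)
  qed
  obtain g where g: "g \<in> A" "g \<noteq> 0" and min: "\<And>a. a \<in> A \<Longrightarrow> a \<noteq> 0 \<Longrightarrow> N g \<le> N a"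
    using ex_has_least_nat[of "\<lambda>a. a \<in> A \<and> a \<noteq> 0" y N] yA assms(3) by auto
  have dvd: "\<exists>q\<in>hurwitz_order. a = g * q" if a: "a \<in> A" for a
  proof -
    obtain q where q: "q \<in> hurwitz_order" "reduced_norm (a - g * q) < reduced_norm g"
      using hurwitz_division[OF g(2)] by blast
    have r: "a - g * q \<in> A" using A_diff a g(1) q(1) by blast
    \<comment> \<open>A nonzero remainder would have smaller norm than the minimal element
      \<open>g\<close>.\<close>
    have "a - g * q = 0"
      using q(2) min[OF r] N[OF r] N[OF g(1)] by fastforce
    then show ?thesis using q(1) by auto
  qed
  from g(1) obtain u v where "u \<in> hurwitz_order" "v \<in> hurwitz_order" "g = x * u + y * v"
    by (auto simp: A_def)
  then show ?thesis using dvd[OF xA] dvd[OF yA] that by blast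
qed

section \<open>Splitting off factors of prime norm\<close>

text \<open>The norm expands to one minus \<open>n\<close> times the trace of \<open>x\<close> plus
  the square of \<open>n\<close> times the norm of \<open>x\<close>. As trace and norm are integers,
  it is congruent to 1 modulo \<open>n\<close>.\<close>

lemma reduced_norm_one_minus_of_int_mult:
  assumes "x \<in> hurwitz_order"
  obtains k :: int where "reduced_norm (1 - of_int n * x) = of_int (1 + n * k)"
proof -
  obtain a b c d where x: "x = hurwitz a b c d" using assms by (rule hurwitz_orderE)
  obtain m where m: "reduced_norm x = of_nat m" using reduced_norm_nat[OF assms] by blast
  have "reduced_norm (1 - of_int n * x) = 1 - of_int n * (2 * qre x) + (of_int n)\<^sup>2 * reduced_norm x"
    by (simp add: reduced_norm_def rquat_defs of_int_rquat qscale_def power2_eq_square algebra_simps)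
  also have "2 * qre x = of_int (2 * a + d)" by (simp add: x hurwitz_def)
  finally have "reduced_norm (1 - of_int n * x) = of_int (1 + n * (n * int m - (2 * a + d)))"
    by (simp add: m power2_eq_square algebra_simps)
  then show ?thesis using that by blast
qed

lemma hurwitz_left_factor_prime:
  assumes x: "x \<in> hurwitz_order" "reduced_norm x = of_nat n" and p: "Factorial_Ring.prime p" "p dvd n"
    and not_dvd: "\<And>c. c \<in> hurwitz_order \<Longrightarrow> x \<noteq> of_int (int p) * c"
  obtains g y where "g \<in> hurwitz_order" "y \<in> hurwitz_order" "x = g * y" "reduced_norm g = of_nat p"
proof -
  let ?p = "of_int (int p) :: rquat"
  have p0: "p > 0" using p(1) by (simp add: prime_gt_0_nat)
  have Np: "reduced_norm ?p = of_nat (p\<^sup>2)" by (simp add: of_int_rquat del: of_int_of_nat_eq)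
  have "?p \<noteq> 0" using p0 Np by (metis reduced_norm_eq_0_iff of_nat_eq_0_iff zero_less_power less_not_refl)
  then obtain g u v s t where D: "u \<in> hurwitz_order" "v \<in> hurwitz_order" "s \<in> hurwitz_order"
    "t \<in> hurwitz_order" and g: "g = x * u + ?p * v" "x = g * s" "?p = g * t"
    using hurwitz_left_gcd[OF x(1) hurwitz_order_of_int[of "int p"]] by metis
  have gD: "g \<in> hurwitz_order"
    unfolding g(1) using D x(1) hurwitz_order_of_int hurwitz_order_add hurwitz_order_closed(2) by blast
  obtain a b where ab: "reduced_norm g = of_nat a" "reduced_norm t = of_nat b"
    using reduced_norm_nat gD D(4) by metis
  \<comment> \<open>Since \<open>p = g * t\<close>, the norm of \<open>g\<close> divides the square
    of \<open>p\<close>; the exponents 0 and 2 remain to be excluded.\<close>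
  have "(of_nat (a * b) :: rat) = of_nat (p\<^sup>2)"
    unfolding Np[symmetric] g(3) reduced_norm_mult ab by simp
  then have abp: "a * b = p\<^sup>2" by (simp only: of_nat_eq_iff)
  then have "a dvd p\<^sup>2" by (metis dvd_triv_left)
  then obtain i where i: "i \<le> 2" "a = p ^ i" using p(1) divides_primepow_nat by blast
  have "i \<noteq> 0"
  proof
    assume "i = 0"
    then have a1: "reduced_norm g = 1" using i ab by simp
    have gg: "g * qconj g = 1" by (simp add: mult_qconj a1)
    \<comment> \<open>Multiplying \<open>g = x * u + p * v\<close> by the inverse
      \<open>qconj g\<close> expresses 1. The two sides then have norms congruent to 1 and 0 modulo
      \<open>p\<close>.\<close>
    have "1 - ?p * (v * qconj g) = x * (u * qconj g)"
      unfolding gg[symmetric] by (subst (1) g(1)) (simp add: algebra_simps)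
    moreover obtain k where "reduced_norm (1 - ?p * (v * qconj g)) = of_int (1 + int p * k)"
      using reduced_norm_one_minus_of_int_mult D(2) gD hurwitz_order_qconj hurwitz_order_closed(2) by metis
    moreover obtain m where "reduced_norm (u * qconj g) = of_nat m"
      using reduced_norm_nat D(1) gD hurwitz_order_qconj hurwitz_order_closed(2) by metis
    ultimately have "(of_int (1 + int p * k) :: rat) = of_int (int n * int m)"
      by (simp add: reduced_norm_mult x(2))
    then have "1 + int p * k = int n * int m" by (simp only: of_int_eq_iff)
    moreover have "int p dvd int n * int m" using p(2) by simp
    ultimately have "int p dvd 1 + int p * k" by metis
    then have "int p dvd 1" by (metis dvd_add_left_iff dvd_triv_left)
    then show False using p(1) by (simp add: prime_nat_iff)
  qed
  moreover have "i \<noteq> 2"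
  proof
    assume "i = 2"
    \<comment> \<open>Now \<open>t\<close> is a unit, so \<open>g\<close> is \<open>p\<close> times
      a unit and \<open>p\<close> divides \<open>x\<close>, contrary to assumption.\<close>
    then have "b = 1" using abp i p0 by simp
    then have tt: "t * qconj t = 1" using ab by (simp add: mult_qconj)
    have "?p * (qconj t * s) = g * (t * qconj t) * s" by (simp only: g(3) mult.assoc)
    then have "x = ?p * (qconj t * s)" by (simp add: tt g(2))
    then show False using not_dvd D hurwitz_order_qconj hurwitz_order_closed(2) by blast
  qed
  ultimately have "i = 1" using i(1) by linarith
  then show ?thesis using that gD D(3) g(2) ab(1) i(2) by simp
qed

lemma sum_two_squares_plus_one_mod_prime:
  assumes "Factorial_Ring.prime p" "odd p"
  obtains a b :: int where "int p dvd a\<^sup>2 + b\<^sup>2 + 1"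
proof -
  obtain m where m: "p = 2 * m + 1" using assms(2) by (rule oddE)
  let ?A = "{0..int m}"
  let ?f = "\<lambda>a. a\<^sup>2 mod int p" and ?g = "\<lambda>b. (- 1 - b\<^sup>2) mod int p"
  have p: "Factorial_Ring.prime (int p)" using assms(1) by simp
  \<comment> \<open>The number \<open>p\<close> divides \<open>a + b\<close> or
    \<open>a - b\<close>. For \<open>a\<close> and \<open>b\<close> between 0 and \<open>m\<close>
    both are smaller than \<open>p\<close> in absolute value, so the one divided is 0; if it is the
    sum, \<open>a\<close> and \<open>b\<close> both vanish.\<close>
  have key: "a = b" if A: "a \<in> ?A" "b \<in> ?A" and dvd: "int p dvd a\<^sup>2 - b\<^sup>2" for a b
  proof -
    have "a\<^sup>2 - b\<^sup>2 = (a + b) * (a - b)" by (simp add: power2_eq_square algebra_simps)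
    then consider "int p dvd a + b" | "int p dvd a - b"
      using dvd p prime_dvd_mult_iff by metis
    then show ?thesis
    proof cases
      case 1
      then have "a + b = 0" using that m zdvd_imp_le[of "int p" "a + b"] by force
      then show ?thesis using that by simp
    next
      case 2
      have "\<bar>a - b\<bar> < int p" using that m by auto
      then show ?thesis using 2 dvd_imp_le_int[of "a - b" "int p"] by force
    qed
  qed
  have f: "inj_on ?f ?A" by (rule inj_onI) (metis key mod_eq_dvd_iff)
  have g: "inj_on ?g ?A"
  proof (rule inj_onI)
    fix a b assume "a \<in> ?A" "b \<in> ?A" "?g a = ?g b"
    moreover from this have "int p dvd (- 1 - a\<^sup>2) - (- 1 - b\<^sup>2)" by (simp only: mod_eq_dvd_iff)
    then have "int p dvd b\<^sup>2 - a\<^sup>2" by simp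
    ultimately show "a = b" using key by metis
  qed
  \<comment> \<open>pigeonhole: two sets of \<open>(p + 1) / 2\<close> residues each\<close>
  have "?f ` ?A \<inter> ?g ` ?A \<noteq> {}"
  proof
    assume disj: "?f ` ?A \<inter> ?g ` ?A = {}"
    have "card (?f ` ?A \<union> ?g ` ?A) = 2 * (m + 1)"
      using disj f g by (simp add: card_Un_disjoint card_image)
    moreover have "?f ` ?A \<union> ?g ` ?A \<subseteq> {0..<int p}" using m by auto
    then have "card (?f ` ?A \<union> ?g ` ?A) \<le> p" using card_mono[of "{0..<int p}"] by fastforce
    ultimately show False using m by simp
  qed
  then obtain a b where "?f a = ?g b" by auto
  then have "int p dvd a\<^sup>2 - (- 1 - b\<^sup>2)" by (simp only: mod_eq_dvd_iff)
  then show ?thesis using that[of a b] by (simp add: algebra_simps)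
qed

text \<open>The element \<open>a + b I + J\<close> has norm divisible by \<open>p\<close> but is not
  itself divisible by \<open>p\<close>, so the preceding factorization provides a left factor of
  norm \<open>p\<close>.\<close>

lemma hurwitz_prime_norm:
  assumes p: "Factorial_Ring.prime p" "odd p"
  obtains g where "g \<in> hurwitz_order" "reduced_norm g = of_nat p"
proof -
  obtain a b where ab: "int p dvd a\<^sup>2 + b\<^sup>2 + 1"
    using sum_two_squares_plus_one_mod_prime[OF p] by blast
  define n where "n = nat (a\<^sup>2 + b\<^sup>2 + 1)"
  have n: "int n = a\<^sup>2 + b\<^sup>2 + 1" by (simp add: n_def)
  have "reduced_norm (hurwitz a b 1 0) = of_int (int n)" by (simp add: reduced_norm_hurwitz n)
  moreover have "p dvd n" using ab n by (metis int_dvd_int_iff)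
  moreover have "hurwitz a b 1 0 \<noteq> of_int (int p) * c" if c: "c \<in> hurwitz_order" for c
  proof
    assume eq: "hurwitz a b 1 0 = of_int (int p) * c"
    obtain a' b' c' d' where c: "c = hurwitz a' b' c' d'" using c by (rule hurwitz_orderE)
    have 1: "of_nat p * (of_int c' + of_int d' / 2) = (1 :: rat)"
      using arg_cong[OF eq, of qj] by (simp add: c hurwitz_def of_int_rquat qscale_def rquat_defs)
    \<comment> \<open>The coefficient of \<open>J\<close> in \<open>c\<close> may be a half-integer,
      so comparing coefficients only shows that \<open>p\<close> divides 2. Oddness of
      \<open>p\<close> excludes this.\<close>
    have "(of_int (int p * (2 * c' + d')) :: rat) = 2 * (of_nat p * (of_int c' + of_int d' / 2))"
      by (simp add: algebra_simps)
    then have "(of_int 2 :: rat) = of_int (int p * (2 * c' + d'))" unfolding 1 by simp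
    then have "2 = int p * (2 * c' + d')" by (simp only: of_int_eq_iff)
    then have "int p dvd int 2" by (metis dvd_triv_left of_nat_numeral)
    then have "p dvd 2" by (simp only: int_dvd_int_iff)
    then show False using p by (metis primes_dvd_imp_eq two_is_prime_nat even_numeral dvd_refl)
  qed
  ultimately show ?thesis
    using hurwitz_left_factor_prime[of "hurwitz a b 1 0" n p] p(1) that
    by (metis hurwitz_in_order of_int_of_nat_eq)
qed

lemma hurwitz_left_factor_odd_prime:
  assumes x: "x \<in> hurwitz_order" "reduced_norm x = of_nat n"
    and p: "Factorial_Ring.prime p" "odd p" "p dvd n"
  obtains g y where "g \<in> hurwitz_order" "y \<in> hurwitz_order" "x = g * y" "reduced_norm g = of_nat p"
proof (cases "\<exists>c\<in>hurwitz_order. x = of_int (int p) * c")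
  case True
  then obtain c where c: "c \<in> hurwitz_order" "x = of_int (int p) * c" by blast
  obtain g where g: "g \<in> hurwitz_order" "reduced_norm g = of_nat p"
    using hurwitz_prime_norm[OF p(1,2)] by blast
  \<comment> \<open>An element \<open>g\<close> of norm \<open>p\<close> satisfies
    \<open>p = g * qconj g\<close>, so it splits off from every multiple of
    \<open>p\<close>.\<close>
  have "x = g * (qconj g * c)"
    by (simp add: mult.assoc[symmetric] mult_qconj g(2) c(2) of_int_rquat del: of_int_of_nat_eq) simp
  then show ?thesis using that g c(1) hurwitz_order_qconj hurwitz_order_closed(2) by blast
next
  case False
  then show ?thesis using hurwitz_left_factor_prime[OF x p(1,3)] that by metis
qed

section \<open>Denominators supported on the given primes\<close>

lemma uminus_ring_of_type_algebra:
  "\<ominus>\<^bsub>(ring_of_type_algebra :: rat ring)\<^esub> r = - r"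
proof -
  interpret ring "ring_of_type_algebra :: rat ring" by (rule ring_from_type_algebra)
  show ?thesis by (rule minus_equality) (auto simp: ring_of_type_algebra_def)
qed

text \<open>Rationals with a denominator composed of primes in \<open>P\<close> form a ring
  containing the generators: for sums and products, the product of the two denominators
  serves.\<close>

lemma inverted_ints_denominator:
  assumes "r \<in> inverted_ints P" and P: "\<And>p. p \<in> P \<Longrightarrow> Factorial_Ring.prime p"
  obtains n :: nat and m :: int
  where "n > 0" "prime_factors n \<subseteq> P" "of_nat n * r = of_int m"
proof -
  have "\<exists>n>0. prime_factors n \<subseteq> P \<and> (\<exists>m. of_nat n * r = of_int m)"
    using assms(1) unfolding inverted_ints_def
  proof (induction rule: generate_ring.induct)
    case one
    show ?case by (intro exI[of _ 1] conjI) (auto simp: ring_of_type_algebra_def intro: exI[of _ 1])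
  next
    case (incl r)
    then obtain p where p: "p \<in> P" "r = 1 / of_nat p" by blast
    have "p > 0" "prime_factors p = {p}"
      using P[OF p(1)] by (simp_all add: prime_gt_0_nat prime_factorization_prime)
    then show ?case using p by (intro exI[of _ p]) (auto intro: exI[of _ 1])
  next
    case (a_inv r)
    then obtain n m where "n > 0" "prime_factors n \<subseteq> P" "of_nat n * r = of_int m" by blast
    then show ?case
      unfolding uminus_ring_of_type_algebra by (intro exI[of _ n]) (auto intro: exI[of _ "- m"])
  next
    case (eng_add r s)
    then obtain n m n' m' where n: "n > 0" "prime_factors n \<subseteq> P" "of_nat n * r = of_int m"
      "n' > 0" "prime_factors n' \<subseteq> P" "of_nat n' * s = of_int m'" by blast
    have "of_nat (n * n') * (r + s) = of_nat n' * (of_nat n * r) + of_nat n * (of_nat n' * s)"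
      by (simp add: algebra_simps)
    also have "\<dots> = of_int (int n' * m + int n * m')" using n by simp
    finally show ?case
      using n
      by (intro exI[of _ "n * n'"] conjI exI[of _ "int n' * m + int n * m'"])
        (auto simp: ring_of_type_algebra_def prime_factors_product)
  next
    case (eng_mult r s)
    then obtain n m n' m' where n: "n > 0" "prime_factors n \<subseteq> P" "of_nat n * r = of_int m"
      "n' > 0" "prime_factors n' \<subseteq> P" "of_nat n' * s = of_int m'" by blast
    have "of_nat (n * n') * (r * s) = (of_nat n * r) * (of_nat n' * s)"
      by (simp add: algebra_simps)
    also have "\<dots> = of_int (m * m')" using n by simp
    finally show ?case
      using n
      by (intro exI[of _ "n * n'"] conjI exI[of _ "m * m'"])
        (auto simp: ring_of_type_algebra_def prime_factors_product)
  qed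
  then show ?thesis using that by blast
qed

lemma S_order_set_denominator:
  assumes "u \<in> S_order_set P" and P: "\<And>p. p \<in> P \<Longrightarrow> Factorial_Ring.prime p"
  obtains n :: nat where "n > 0" "prime_factors n \<subseteq> P" "qscale (of_nat n) u \<in> hurwitz_order"
proof -
  \<comment> \<open>Stated for pure tensors separately, since the induction over
    \<open>generate\<close> needs it both for generators and for their negatives.\<close>
  have base: "\<exists>n>0. prime_factors n \<subseteq> P \<and> qscale (of_nat n) u \<in> hurwitz_order"
    if u: "u \<in> {qscale r x | r x. r \<in> inverted_ints P \<and> x \<in> hurwitz_order}" for u
  proof -
    obtain r x where rx: "r \<in> inverted_ints P" "x \<in> hurwitz_order" "u = qscale r x" using u by blast
    obtain n m where "n > 0" "prime_factors n \<subseteq> P" "of_nat n * r = of_int m"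
      using inverted_ints_denominator[OF rx(1) P] by blast
    moreover from this have "qscale (of_nat n) u \<in> hurwitz_order"
      using hurwitz_order_of_int_mult[OF rx(2)] by (simp add: rx(3))
    ultimately show ?thesis by blast
  qed
  have "\<exists>n>0. prime_factors n \<subseteq> P \<and> qscale (of_nat n) u \<in> hurwitz_order"
    using assms(1) unfolding S_order_set_def
  proof (induction rule: generate.induct)
    case one
    have "qscale (of_nat 1) 0 \<in> hurwitz_order" using hurwitz_order_of_int[of 0] by simp
    then show ?case by (intro exI[of _ 1]) simp
  next
    case (incl u)
    then show ?case by (rule base)
  next
    case (inv u)
    then obtain n where "n > 0" "prime_factors n \<subseteq> P" "qscale (of_nat n) u \<in> hurwitz_order"
      using base by blast
    moreover have "inv\<^bsub>add_monoid hamilton_Q\<^esub> u = - u"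
      using a_inv_hamilton_Q[of u] unfolding a_inv_def .
    ultimately show ?case using hurwitz_order_minus by (auto simp: qscale_minus)
  next
    case (eng u v)
    then obtain n n' where n: "n > 0" "prime_factors n \<subseteq> P" "qscale (of_nat n) u \<in> hurwitz_order"
      "n' > 0" "prime_factors n' \<subseteq> P" "qscale (of_nat n') v \<in> hurwitz_order" by blast
    have "qscale (of_nat (n * n')) (u + v) =
      qscale (of_int (int n')) (qscale (of_nat n) u) + qscale (of_int (int n)) (qscale (of_nat n') v)"
      by (simp add: qscale_add mult.commute)
    also have "\<dots> \<in> hurwitz_order"
      by (intro hurwitz_order_add hurwitz_order_of_int_mult n)
    finally show ?case
      using n by (intro exI[of _ "n * n'"]) (auto simp: prime_factors_product simp del: of_nat_mult)
  qed
  then show ?thesis using that by blast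
qed

section \<open>Units and their norms\<close>

lemma S_unit_group_carrier:
  "u \<in> carrier (S_unit_group P) \<longleftrightarrow>
   u \<in> S_order_set P \<and> (\<exists>v\<in>S_order_set P. u * v = 1 \<and> v * u = 1)"
  by (auto simp: S_unit_group_def units_of_carrier Units_def S_order_def)

lemma S_unit_group_simps [simp]:
  "x \<otimes>\<^bsub>S_unit_group P\<^esub> y = x * y" "\<one>\<^bsub>S_unit_group P\<^esub> = 1"
  by (simp_all add: S_unit_group_def units_of_mult units_of_one S_order_def)

text \<open>The inverse of \<open>x\<close> is its conjugate divided by its norm \<open>r\<close>,
  and it lies in the S-order as soon as \<open>1 / r\<close> is an allowed scalar.\<close>

lemma S_unit_of_reduced_norm:
  assumes "x \<in> hurwitz_order" "reduced_norm x = r" "r \<noteq> 0" "1 / r \<in> inverted_ints P"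
  shows "x \<in> carrier (S_unit_group P)"
proof -
  have "x \<in> S_order_set P" using assms(1) hurwitz_order_subset_S_order by (auto simp: S_order_def)
  moreover have "qscale (1 / r) (qconj x) \<in> S_order_set P"
    unfolding S_order_set_def using assms(1,4) hurwitz_order_qconj by (blast intro: generate.incl)
  moreover have "x * qscale (1 / r) (qconj x) = 1" "qscale (1 / r) (qconj x) * x = 1"
    using assms(2,3) by (simp_all add: qscale_mult mult_qconj)
  ultimately show ?thesis unfolding S_unit_group_carrier by blast
qed

text \<open>Clear denominators in \<open>u\<close> and in its inverse \<open>v\<close> by
  \<open>n\<close> and \<open>m\<close>. The two resulting integral norms multiply to the square of
  \<open>n * m\<close>, so only primes in \<open>P\<close> divide either of them.\<close>

lemma S_unit_reduced_norm:
  assumes u: "u \<in> carrier (S_unit_group P)" and P: "\<And>p. p \<in> P \<Longrightarrow> Factorial_Ring.prime p"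
  obtains n k :: nat where "n > 0" "prime_factors n \<subseteq> P" "qscale (of_nat n) u \<in> hurwitz_order"
    "k > 0" "prime_factors k \<subseteq> P" "reduced_norm (qscale (of_nat n) u) = of_nat k"
proof -
  obtain v where v: "u \<in> S_order_set P" "v \<in> S_order_set P" "u * v = 1"
    using u unfolding S_unit_group_carrier by blast
  obtain n where n: "n > 0" "prime_factors n \<subseteq> P" "qscale (of_nat n) u \<in> hurwitz_order"
    using S_order_set_denominator[OF v(1) P] by blast
  obtain m where m: "m > 0" "prime_factors m \<subseteq> P" "qscale (of_nat m) v \<in> hurwitz_order"
    using S_order_set_denominator[OF v(2) P] by blast
  obtain k where k: "reduced_norm (qscale (of_nat n) u) = of_nat k"
    using reduced_norm_nat[OF n(3)] by blast
  obtain j where j: "reduced_norm (qscale (of_nat m) v) = of_nat j"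
    using reduced_norm_nat[OF m(3)] by blast
  have "(of_nat (k * j) :: rat) = reduced_norm (qscale (of_nat n) u * qscale (of_nat m) v)"
    by (simp only: of_nat_mult k j reduced_norm_mult)
  also have "\<dots> = of_nat ((n * m)\<^sup>2)"
    by (simp add: qscale_mult v(3) power_mult_distrib mult.commute)
  finally have "(of_nat (k * j) :: rat) = of_nat ((n * m)\<^sup>2)" .
  then have kj: "k * j = (n * m)\<^sup>2" by (simp only: of_nat_eq_iff)
  then have "k * j > 0" using n(1) m(1) by simp
  then have "k > 0" "j > 0" by simp_all
  have "prime_factors k \<subseteq> prime_factors ((n * m)\<^sup>2)"
    unfolding kj[symmetric] using \<open>k > 0\<close> \<open>j > 0\<close> by (simp add: prime_factors_product)
  also have "\<dots> \<subseteq> P"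
    using n m by (simp add: prime_factors_product power2_eq_square)
  finally show ?thesis using that n k \<open>k > 0\<close> by blast
qed

theorem theorem1p2:
  fixes h :: nat and l :: "nat \<Rightarrow> nat"
  assumes "inj_on l {1..h}"
    and "\<And>i. i \<in> {1..h} \<Longrightarrow> Factorial_Ring.prime (l i) \<and> odd (l i)"
  defines "P \<equiv> l ` {1..h}"
    and "G \<equiv> {x \<in> hurwitz_order. reduced_norm x \<in> {1} \<union> (\<lambda>i. of_nat (l i)) ` {1..h}}"
  shows "finite G \<and> G \<subseteq> carrier (S_unit_group P) \<and>
    generate (S_unit_group P) G = carrier (S_unit_group P)"
proof -
  have P: "Factorial_Ring.prime p" "odd p" if "p \<in> P" for p
    using that assms(2) by (auto simp: P_def)
  have G: "x \<in> G \<longleftrightarrow> x \<in> hurwitz_order \<and> (reduced_norm x = 1 \<or> (\<exists>p\<in>P. reduced_norm x = of_nat p))" for x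
    by (auto simp: G_def P_def)
  interpret group "S_unit_group P" by (rule group_S_unit_group)
  have fin: "finite G"
  proof (rule finite_subset)
    \<comment> \<open>Any common bound for 1 and the primes in \<open>P\<close> will do;
      \<open>1 + sum id P\<close> is one.\<close>
    have "p \<le> 1 + sum id P" if "p \<in> P" for p
      using that member_le_sum[of p P id] by (simp add: P_def)
    then have "(of_nat p :: rat) \<le> of_nat (1 + sum id P)" if "p \<in> P" for p
      using that by (simp only: of_nat_le_iff)
    moreover have "(1 :: rat) \<le> of_nat (1 + sum id P)"
      by (simp add: sum_nonneg)
    ultimately show "G \<subseteq> {x \<in> hurwitz_order. reduced_norm x \<le> of_nat (1 + sum id P)}"
      unfolding subset_iff G by (metis (mono_tags, lifting) mem_Collect_eq)
  qed (rule finite_hurwitz_order_reduced_norm)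
  have sub: "G \<subseteq> carrier (S_unit_group P)"
  proof
    fix x assume "x \<in> G"
    then consider "x \<in> hurwitz_order" "reduced_norm x = 1"
      | p where "x \<in> hurwitz_order" "p \<in> P" "reduced_norm x = of_nat p"
      unfolding G by blast
    then show "x \<in> carrier (S_unit_group P)"
    proof cases
      case 1
      then show ?thesis using S_unit_of_reduced_norm[of x 1] inverted_ints_closed(1) by simp
    next
      case 2
      have "1 / of_nat p \<in> inverted_ints P"
        unfolding inverted_ints_def using 2(2) by (blast intro: generate_ring.incl)
      moreover have "p \<noteq> 0" using P(1)[OF 2(2)] by (metis not_prime_0)
      ultimately show ?thesis using S_unit_of_reduced_norm[OF 2(1,3)] by simp
    qed
  qed
  let ?A = "generate (S_unit_group P) G"
  \<comment> \<open>Induction on the norm: a left factor of prime norm lies in \<open>G\<close>, and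
    the cofactor has smaller norm. Elements of norm 1 belong to \<open>G\<close> themselves.\<close>
  have key: "x \<in> ?A" if "x \<in> hurwitz_order" "reduced_norm x = of_nat n" "n > 0" "prime_factors n \<subseteq> P" for x n
    using that
  proof (induction n arbitrary: x rule: less_induct)
    case (less n)
    show ?case
    proof (cases "n = 1")
      case True
      then have "x \<in> G" using less.prems by (simp add: G)
      then show ?thesis by (rule generate.incl)
    next
      case False
      then obtain p where p: "Factorial_Ring.prime p" "p dvd n" using prime_factor_nat by blast
      then have "p \<in> P" using less.prems(3,4) by (auto simp: in_prime_factors_iff)
      obtain g y where g: "g \<in> hurwitz_order" "y \<in> hurwitz_order" "x = g * y" "reduced_norm g = of_nat p"
        using hurwitz_left_factor_odd_prime[OF less.prems(1,2) p(1) P(2)[OF \<open>p \<in> P\<close>] p(2)] by blast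
      obtain m where m: "reduced_norm y = of_nat m" using reduced_norm_nat[OF g(2)] by blast
      have "(of_nat n :: rat) = of_nat (p * m)"
        using less.prems(2) by (simp add: g m reduced_norm_mult)
      then have n: "n = p * m" by (simp only: of_nat_eq_iff)
      have pos: "p > 0" "m > 0" using less.prems(3) by (simp_all add: n)
      then have "m < n" using prime_gt_1_nat[OF p(1)] by (simp add: n)
      moreover have "prime_factors m \<subseteq> P"
        using less.prems(4) pos by (simp add: n prime_factors_product)
      ultimately have "y \<in> ?A" using less.IH g(2) m pos by blast
      moreover have "g \<in> G" using g \<open>p \<in> P\<close> by (auto simp: G)
      then have "g \<in> ?A" by (rule generate.incl)
      ultimately show ?thesis
        using generate.eng[of g "S_unit_group P" G y] by (simp add: g(3))
    qed
  qed
  have "u \<in> ?A" if u: "u \<in> carrier (S_unit_group P)" for u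
  proof -
    obtain n k where n: "n > 0" "prime_factors n \<subseteq> P" "qscale (of_nat n) u \<in> hurwitz_order"
      and k: "k > 0" "prime_factors k \<subseteq> P" "reduced_norm (qscale (of_nat n) u) = of_nat k"
      using S_unit_reduced_norm[OF u P(1)] by blast
    have x: "qscale (of_nat n) u \<in> ?A" using key[OF n(3) k(3,1,2)] .
    \<comment> \<open>The denominator, viewed as a scalar quaternion, has norm the square of
      \<open>n\<close>, so \<open>key\<close> applies to it as well and \<open>u\<close> is a
      quotient of two elements of \<open>?A\<close>.\<close>
    let ?n = "qscale (of_nat n) 1"
    have "?n \<in> hurwitz_order"
      using hurwitz_order_of_int_mult[OF hurwitz_order_closed(1), of "int n"] by simp
    moreover have "reduced_norm ?n = of_nat (n\<^sup>2)" by simp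
    moreover have "prime_factors (n\<^sup>2) \<subseteq> P" using n by (simp add: prime_factors_product power2_eq_square)
    ultimately have nA: "?n \<in> ?A" using key[of ?n "n\<^sup>2"] n(1) by simp
    have "?n \<otimes>\<^bsub>S_unit_group P\<^esub> u = qscale (of_nat n) u" by (simp add: qscale_mult)
    then have "u = inv\<^bsub>S_unit_group P\<^esub> ?n \<otimes>\<^bsub>S_unit_group P\<^esub> qscale (of_nat n) u"
      using inv_solve_left u nA x generate_in_carrier[OF sub] by metis
    then show ?thesis
      using generate.eng[OF generate_m_inv_closed[OF sub nA] x] by simp
  qed
  then have "?A = carrier (S_unit_group P)"
    using generate_in_carrier[OF sub] by blast
  with fin sub show ?thesis by blast
qed

end
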